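(* Let $\mathcal{O}$ be a non-symmetric operad and let $\pi\in\mathcal{O}(2)$ be a multiplication on $\mathcal{O}$. There is a one-to-one correspondence between the set of equivalence classes of infinitesimal deformations of $\pi$ and the second cohomology $H^2(\mathcal{O},d_\pi)$.
   Context: All vector spaces are over a field $\mathbb{K}$ of characteristic $0$. A non-symmetric operad is a collection $\mathcal{O}=\{\mathcal{O}(n)\}_{n\ge 1}$ of vector spaces with bilinear partial compositions $\circ_i:\mathcal{O}(m)\otimes\mathcal{O}(n)\to\mathcal{O}(m+n-1)$, $1\le i\le m$, such that for $f\in\mathcal{O}(m), g\in\mathcal{O}(n), h\in\mathcal{O}(p)$: $(f\circ_i g)\circ_{i+j-1}h=f\circ_i(g\circ_j h)$ for $1\le i\le m,\ 1\le j\le n$; $(f\circ_i g)\circ_{j+n-1}h=(f\circ_j h)\circ_i g$ for $1\le i<j\le m$; and an element $\mathrm{id}\in\mathcal{O}(1)$ with $f\circ_i\mathrm{id}=f=\mathrm{id}\circ_1 f$. For $f\in\mathcal{O}(n)$ put $|f|=n-1$. For $f \in \mathcal{O}(2)$ and $g,h\in\mathcal{O}(1)$ write $\gamma(f;g,h)=(f\circ_2 h)\circ_1 g$. The circle product is $f\circ g=\sum_{i=1}^m(-1)^{(i-1)|g|}f\circ_i g$ for $f\in\mathcal{O}(m)$. A multiplication on $\mathcal{O}$ is an element $\pi\in\mathcal{O}(2)$ with $\pi\circ\pi=0$ (equivalently $\pi\circ_1\pi=\pi\circ_2\pi$). It defines a differential $d_\pi:\mathcal{O}(n)\to\mathcal{O}(n+1)$,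 $d_\pi f=\pi\circ f-(-1)^{|f|}f\circ\pi$, and $H^n(\mathcal{O},d_\pi)$ denotes the cohomology at $\mathcal{O}(n)$. All operations are extended $\mathbb{K}[[t]]$-linearly to formal power series $\mathcal{O}(n)[[t]]$. An infinitesimal deformation of $\pi$ is a sum $\pi_t=\pi+\pi_1t$ with $\pi_1\in\mathcal{O}(2)$ and $\pi_t\circ\pi_t\equiv 0 \pmod{t^2}$. Two infinitesimal deformations $\pi_t,\pi_t'$ are equivalent if there is $\phi_t=\mathrm{id}+\phi_1t$ with $\phi_1\in\mathcal{O}(1)$ such that $\phi_t\circ\pi_t'\equiv\gamma(\pi_t;\phi_t,\phi_t)\pmod{t^2}$. *)

theory Defs
  imports "HOL-Computational_Algebra.Formal_Power_Series"
begin

text \<open>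
  The components of a non-symmetric operad are subspaces \<open>Op n\<close> (\<open>n \<ge> 1\<close>) of an ambient vector
  space. This is no restriction, since any family of vector spaces embeds in its direct sum. The
  subspaces are not assumed to be independent, so an element does not determine its arity and every
  operation carries the arities of its arguments: \<open>pcomp m n i f g\<close> is \<open>f \<circ>\<^sub>i g\<close> for \<open>f\<close> in
  \<open>Op m\<close> and \<open>g\<close> in \<open>Op n\<close>. Nothing is required of \<open>Op 0\<close>, or of \<open>pcomp\<close> outside its domain.
\<close>

locale ns_operad = vector_space scale
  for scale :: "'k::field_char_0 \<Rightarrow> 'v::ab_group_add \<Rightarrow> 'v" (infixr \<open>*s\<close> 75) +
  fixes Op :: "nat \<Rightarrow> 'v set"
    and pcomp :: "nat \<Rightarrow> nat \<Rightarrow> nat \<Rightarrow> 'v \<Rightarrow> 'v \<Rightarrow> 'v"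
    and ident :: 'v
  assumes subspace_Op: "n \<ge> 1 \<Longrightarrow> subspace (Op n)"
    and pcomp_closed:
      "\<lbrakk>1 \<le> i; i \<le> m; 1 \<le> n; f \<in> Op m; g \<in> Op n\<rbrakk> \<Longrightarrow> pcomp m n i f g \<in> Op (m + n - 1)"
    and pcomp_add_left:
      "\<lbrakk>1 \<le> i; i \<le> m; 1 \<le> n; f \<in> Op m; f' \<in> Op m; g \<in> Op n\<rbrakk> \<Longrightarrow>
        pcomp m n i (f + f') g = pcomp m n i f g + pcomp m n i f' g"
    and pcomp_scale_left:
      "\<lbrakk>1 \<le> i; i \<le> m; 1 \<le> n; f \<in> Op m; g \<in> Op n\<rbrakk> \<Longrightarrow>
        pcomp m n i (c *s f) g = c *s pcomp m n i f g"
    and pcomp_add_right: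
      "\<lbrakk>1 \<le> i; i \<le> m; 1 \<le> n; f \<in> Op m; g \<in> Op n; g' \<in> Op n\<rbrakk> \<Longrightarrow>
        pcomp m n i f (g + g') = pcomp m n i f g + pcomp m n i f g'"
    and pcomp_scale_right:
      "\<lbrakk>1 \<le> i; i \<le> m; 1 \<le> n; f \<in> Op m; g \<in> Op n\<rbrakk> \<Longrightarrow>
        pcomp m n i f (c *s g) = c *s pcomp m n i f g"
    and pcomp_assoc_sequential:
      "\<lbrakk>1 \<le> i; i \<le> m; 1 \<le> j; j \<le> n; 1 \<le> p; f \<in> Op m; g \<in> Op n; h \<in> Op p\<rbrakk> \<Longrightarrow>
        pcomp (m + n - 1) p (i + j - 1) (pcomp m n i f g) h =
        pcomp m (n + p - 1) i f (pcomp n p j g h)"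
    and pcomp_assoc_parallel:
      "\<lbrakk>1 \<le> i; i < j; j \<le> m; 1 \<le> n; 1 \<le> p; f \<in> Op m; g \<in> Op n; h \<in> Op p\<rbrakk> \<Longrightarrow>
        pcomp (m + n - 1) p (j + n - 1) (pcomp m n i f g) h =
        pcomp (m + p - 1) n i (pcomp m p j f h) g"
    and ident_mem: "ident \<in> Op 1"
    and pcomp_ident_right: "\<lbrakk>1 \<le> i; i \<le> m; f \<in> Op m\<rbrakk> \<Longrightarrow> pcomp m 1 i f ident = f"
    and pcomp_ident_left: "\<lbrakk>1 \<le> m; f \<in> Op m\<rbrakk> \<Longrightarrow> pcomp 1 m 1 ident f = f"
begin

definition circle :: "nat \<Rightarrow> nat \<Rightarrow> 'v \<Rightarrow> 'v \<Rightarrow> 'v" where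
  "circle m n f g = (\<Sum>i=1..m. ((- 1) ^ ((i - 1) * (n - 1))) *s pcomp m n i f g)"

definition multiplication :: "'v \<Rightarrow> bool" where
  "multiplication \<pi> \<longleftrightarrow> \<pi> \<in> Op 2 \<and> circle 2 2 \<pi> \<pi> = 0"

definition differential :: "'v \<Rightarrow> nat \<Rightarrow> 'v \<Rightarrow> 'v" where
  "differential \<pi> n f = circle 2 n \<pi> f - ((- 1) ^ (n - 1)) *s circle n 2 f \<pi>"

definition cocycles :: "'v \<Rightarrow> nat \<Rightarrow> 'v set" where
  "cocycles \<pi> n = {f \<in> Op n. differential \<pi> n f = 0}"

text \<open>The complex starts in arity 1, so there are no nonzero coboundaries there.\<close>

definition coboundaries :: "'v \<Rightarrow> nat \<Rightarrow> 'v set" where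
  "coboundaries \<pi> n = (if n \<le> 1 then {0} else differential \<pi> (n - 1) ` Op (n - 1))"

definition cohomologous :: "'v \<Rightarrow> nat \<Rightarrow> ('v \<times> 'v) set" where
  "cohomologous \<pi> n =
    {(f, g). f \<in> cocycles \<pi> n \<and> g \<in> cocycles \<pi> n \<and> f - g \<in> coboundaries \<pi> n}"

definition cohomology :: "'v \<Rightarrow> nat \<Rightarrow> 'v set set" where
  "cohomology \<pi> n = cocycles \<pi> n // cohomologous \<pi> n"

text \<open>
  \<open>Op_series n\<close> is \<open>Op n [[t]]\<close>. The \<open>K[[t]]\<close>-module structure and the
  \<open>K[[t]]\<close>-bilinear extension of partial composition are both given by Cauchy products.
\<close>

definition Op_series :: "nat \<Rightarrow> 'v fps set" where
  "Op_series n = {F. \<forall>k. fps_nth F k \<in> Op n}"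

definition series_scale :: "'k fps \<Rightarrow> 'v fps \<Rightarrow> 'v fps" where
  "series_scale a F = Abs_fps (\<lambda>k. \<Sum>j\<le>k. fps_nth a j *s fps_nth F (k - j))"

definition series_pcomp :: "nat \<Rightarrow> nat \<Rightarrow> nat \<Rightarrow> 'v fps \<Rightarrow> 'v fps \<Rightarrow> 'v fps" where
  "series_pcomp m n i F G =
    Abs_fps (\<lambda>k. \<Sum>j\<le>k. pcomp m n i (fps_nth F j) (fps_nth G (k - j)))"

definition series_circle :: "nat \<Rightarrow> nat \<Rightarrow> 'v fps \<Rightarrow> 'v fps \<Rightarrow> 'v fps" where
  "series_circle m n F G =
    (\<Sum>i=1..m. series_scale ((- 1) ^ ((i - 1) * (n - 1))) (series_pcomp m n i F G))"

text \<open>\<open>\<gamma>(F; G, H) = (F \<circ>\<^sub>2 H) \<circ>\<^sub>1 G\<close> for \<open>F\<close> of arity 2 and \<open>G\<close>, \<open>H\<close> of arity 1.\<close>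

definition series_gamma :: "'v fps \<Rightarrow> 'v fps \<Rightarrow> 'v fps \<Rightarrow> 'v fps" where
  "series_gamma F G H = series_pcomp 2 1 1 (series_pcomp 2 1 2 F H) G"

text \<open>Congruence of elements of \<open>Op n [[t]]\<close> modulo \<open>t\<^sup>N\<close>.\<close>

definition cong_mod_t :: "nat \<Rightarrow> nat \<Rightarrow> 'v fps \<Rightarrow> 'v fps \<Rightarrow> bool" where
  "cong_mod_t n N F G \<longleftrightarrow> (\<exists>H\<in>Op_series n. F - G = series_scale (fps_X ^ N) H)"

text \<open>\<open>linear_series x y\<close> is the series \<open>x + y t\<close>.\<close>

definition linear_series :: "'v \<Rightarrow> 'v \<Rightarrow> 'v fps" where
  "linear_series x y = fps_const x + series_scale fps_X (fps_const y)"

definition inf_deformations :: "'v \<Rightarrow> 'v fps set" where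
  "inf_deformations \<pi> =
    {P. \<exists>\<pi>1\<in>Op 2. P = linear_series \<pi> \<pi>1 \<and> cong_mod_t 3 2 (series_circle 2 2 P P) 0}"

definition inf_deformation_equiv :: "'v \<Rightarrow> ('v fps \<times> 'v fps) set" where
  "inf_deformation_equiv \<pi> =
    {(P, P'). P \<in> inf_deformations \<pi> \<and> P' \<in> inf_deformations \<pi> \<and>
      (\<exists>\<phi>1\<in>Op 1. let \<phi> = linear_series ident \<phi>1 in
        cong_mod_t 2 2 (series_circle 1 2 \<phi> P') (series_gamma P \<phi> \<phi>))}"

end

end

theory Submission
  imports Defs
begin

text \<open>
  Comparing coefficients of \<open>t\<close>, the series \<open>\<pi> + \<pi>\<^sub>1 t\<close> is an infinitesimal deformation iff
  \<open>\<pi> \<circ> \<pi>\<^sub>1 + \<pi>\<^sub>1 \<circ> \<pi> = 0\<close>, which is \<open>d\<^sub>\<pi> \<pi>\<^sub>1 = 0\<close>, and \<open>id + \<phi>\<^sub>1 t\<close> is an equivalence from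
  \<open>\<pi> + \<pi>\<^sub>1 t\<close> to \<open>\<pi> + \<pi>\<^sub>1' t\<close> iff
  \<open>\<pi>\<^sub>1' + \<phi>\<^sub>1 \<circ> \<pi> = \<pi>\<^sub>1 + \<pi> \<circ>\<^sub>1 \<phi>\<^sub>1 + \<pi> \<circ>\<^sub>2 \<phi>\<^sub>1\<close>, which is \<open>\<pi>\<^sub>1' - \<pi>\<^sub>1 = d\<^sub>\<pi> \<phi>\<^sub>1\<close>. So the
  injection \<open>\<pi>\<^sub>1 \<mapsto> \<pi> + \<pi>\<^sub>1 t\<close> carries 2-cocycles onto infinitesimal deformations and the
  relation of being cohomologous onto equivalence.
\<close>

section \<open>Transport of equivalence relations and quotients along an injection\<close>

lemma equiv_map_prod_image:
  assumes "equiv A r" "inj_on f A"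
  shows "equiv (f ` A) (map_prod f f ` r)"
proof -
  have sub: "r \<subseteq> A \<times> A" and "refl_on A r" "sym r" "trans r"
    using assms(1) by (auto simp: equiv_def)
  show ?thesis
  proof (rule equivI)
    show "map_prod f f ` r \<subseteq> f ` A \<times> f ` A"
      using sub by auto
    show "refl_on (f ` A) (map_prod f f ` r)"
      using \<open>refl_on A r\<close> by (force simp: refl_on_def)
    show "sym (map_prod f f ` r)"
      using \<open>sym r\<close> by (force simp: sym_def)
    show "trans (map_prod f f ` r)"
    proof (rule transI)
      fix x y z
      assume "(x, y) \<in> map_prod f f ` r" "(y, z) \<in> map_prod f f ` r"
      then obtain a b b' c where *: "(a, b) \<in> r" "(b', c) \<in> r" "x = f a" "y = f b" "y = f b'" "z = f c"
        by auto
      \<comment> \<open>The middle element \<open>y\<close> comes with two preimages in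
        \<open>A\<close>; injectivity identifies them, so that transitivity of \<open>r\<close>
        applies.\<close>
      then have "b = b'"
        using sub assms(2) by (auto dest: inj_onD)
      then show "(x, z) \<in> map_prod f f ` r"
        using * \<open>trans r\<close> by (force dest: transD)
    qed
  qed
qed

text \<open>By injectivity, a pair of the image relation that starts at \<open>f a\<close> comes
  from a pair of \<open>r\<close> that starts at \<open>a\<close> itself. Hence classes are carried
  onto whole classes.\<close>

lemma map_prod_image_Image:
  assumes "r \<subseteq> A \<times> A" "inj_on f A" "a \<in> A"
  shows "(map_prod f f ` r) `` {f a} = f ` (r `` {a})"
  using assms by (force dest: inj_onD)

lemma quotient_map_prod_image:
  assumes "r \<subseteq> A \<times> A" "inj_on f A"
  shows "(f ` A) // (map_prod f f ` r) = (`) f ` (A // r)"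
  using map_prod_image_Image[OF assms] by (auto simp: quotient_def)

context ns_operad
begin

section \<open>Linearity of the circle product and of the differential\<close>

lemma Op_zero [simp]: "n \<ge> 1 \<Longrightarrow> 0 \<in> Op n"
  using subspace_Op subspace_0 by blast

lemma Op_add [intro]: "\<lbrakk>n \<ge> 1; f \<in> Op n; g \<in> Op n\<rbrakk> \<Longrightarrow> f + g \<in> Op n"
  using subspace_Op subspace_add by blast

lemma Op_diff [intro]: "\<lbrakk>n \<ge> 1; f \<in> Op n; g \<in> Op n\<rbrakk> \<Longrightarrow> f - g \<in> Op n"
  using subspace_Op subspace_diff by blast

lemma Op_scale [intro]: "\<lbrakk>n \<ge> 1; f \<in> Op n\<rbrakk> \<Longrightarrow> c *s f \<in> Op n"
  using subspace_Op subspace_scale by blast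

lemma Op_sum: "\<lbrakk>n \<ge> 1; \<And>i. i \<in> I \<Longrightarrow> f i \<in> Op n\<rbrakk> \<Longrightarrow> (\<Sum>i\<in>I. f i) \<in> Op n"
  using subspace_Op subspace_sum by blast

lemma circle_closed:
  "\<lbrakk>1 \<le> m; 1 \<le> n; f \<in> Op m; g \<in> Op n\<rbrakk> \<Longrightarrow> circle m n f g \<in> Op (m + n - 1)"
  unfolding circle_def by (intro Op_sum Op_scale pcomp_closed) auto

lemma circle_1_left: "circle 1 n f g = pcomp 1 n 1 f g"
  by (simp add: circle_def)

lemma circle_2_left:
  "circle 2 n f g = pcomp 2 n 1 f g + (- 1) ^ (n - 1) *s pcomp 2 n 2 f g"
  by (simp add: circle_def numeral_2_eq_2)

lemma circle_add_left:
  "\<lbrakk>1 \<le> n; f \<in> Op m; f' \<in> Op m; g \<in> Op n\<rbrakk> \<Longrightarrow>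
    circle m n (f + f') g = circle m n f g + circle m n f' g"
  by (simp add: circle_def pcomp_add_left scale_right_distrib sum.distrib)

lemma circle_add_right:
  "\<lbrakk>1 \<le> n; f \<in> Op m; g \<in> Op n; g' \<in> Op n\<rbrakk> \<Longrightarrow>
    circle m n f (g + g') = circle m n f g + circle m n f g'"
  by (simp add: circle_def pcomp_add_right scale_right_distrib sum.distrib)

lemma differential_add:
  assumes "\<pi> \<in> Op 2" "n \<ge> 1" "f \<in> Op n" "g \<in> Op n"
  shows "differential \<pi> n (f + g) = differential \<pi> n f + differential \<pi> n g"
  using assms
  by (simp add: differential_def circle_add_left circle_add_right scale_right_distrib)

lemma differential_zero:
  "\<lbrakk>\<pi> \<in> Op 2; n \<ge> 1\<rbrakk> \<Longrightarrow> differential \<pi> n 0 = 0"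
  using differential_add[of \<pi> n 0 0] by simp

lemma differential_diff:
  assumes "\<pi> \<in> Op 2" "n \<ge> 1" "f \<in> Op n" "g \<in> Op n"
  shows "differential \<pi> n (f - g) = differential \<pi> n f - differential \<pi> n g"
  using differential_add[of \<pi> n "f - g" g] assms by (simp add: Op_diff)

section \<open>Coboundaries and the relation of being cohomologous\<close>

lemma coboundaries_zero:
  assumes "\<pi> \<in> Op 2"
  shows "0 \<in> coboundaries \<pi> n"
  using assms differential_zero[of \<pi> "n - 1"] by (force simp: coboundaries_def)

lemma coboundaries_diff:
  assumes "\<pi> \<in> Op 2" "f \<in> coboundaries \<pi> n" "g \<in> coboundaries \<pi> n"
  shows "f - g \<in> coboundaries \<pi> n"
proof (cases "n \<le> 1")
  case False
  then obtain a b where "f = differential \<pi> (n - 1) a" "g = differential \<pi> (n - 1) b"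
      "a \<in> Op (n - 1)" "b \<in> Op (n - 1)"
    using assms by (auto simp: coboundaries_def)
  with False assms show ?thesis
    by (auto simp: coboundaries_def differential_diff intro!: image_eqI[of _ _ "a - b"])
qed (use assms in \<open>auto simp: coboundaries_def\<close>)

text \<open>The coboundaries contain \<open>0\<close> and are closed under differences, which
  suffices: symmetry uses \<open>g - f = 0 - (f - g)\<close> and transitivity uses
  \<open>f - h = (g - h) - (g - f)\<close>.\<close>

lemma equiv_cohomologous:
  assumes "\<pi> \<in> Op 2"
  shows "equiv (cocycles \<pi> n) (cohomologous \<pi> n)"
proof (rule equivI)
  show "refl_on (cocycles \<pi> n) (cohomologous \<pi> n)"
    using coboundaries_zero[OF assms] by (auto simp: cohomologous_def refl_on_def)
  show "sym (cohomologous \<pi> n)"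
    using coboundaries_diff[OF assms coboundaries_zero[OF assms]]
    by (fastforce simp: cohomologous_def sym_def)
  show "trans (cohomologous \<pi> n)"
  proof (rule transI)
    fix f g h
    assume fg: "(f, g) \<in> cohomologous \<pi> n" and gh: "(g, h) \<in> cohomologous \<pi> n"
    have "g - f \<in> coboundaries \<pi> n"
      using fg coboundaries_diff[OF assms coboundaries_zero[OF assms], of "f - g"]
      by (simp add: cohomologous_def)
    moreover have "g - h \<in> coboundaries \<pi> n"
      using gh by (simp add: cohomologous_def)
    ultimately have "(g - h) - (g - f) \<in> coboundaries \<pi> n"
      using coboundaries_diff[OF assms] by blast
    then show "(f, h) \<in> cohomologous \<pi> n"
      using fg gh by (simp add: cohomologous_def)
  qed
qed (auto simp: cohomologous_def)

section \<open>Coefficients of power series and congruence modulo \<open>t^N\<close>\<close>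

lemma series_scale_const_nth: "fps_nth (series_scale (fps_const c) F) k = c *s fps_nth F k"
proof -
  have "(\<Sum>j\<le>k. fps_nth (fps_const c) j *s fps_nth F (k - j)) =
      (\<Sum>j\<le>k. if j = 0 then c *s fps_nth F k else 0)"
    by (rule sum.cong) auto
  then show ?thesis
    by (simp add: series_scale_def)
qed

lemma series_scale_X_power_nth:
  "fps_nth (series_scale (fps_X ^ N) F) k = (if k < N then 0 else fps_nth F (k - N))"
proof -
  have "(\<Sum>j\<le>k. fps_nth (fps_X ^ N :: 'k fps) j *s fps_nth F (k - j)) =
      (\<Sum>j\<le>k. if j = N then fps_nth F (k - N) else 0)"
    by (rule sum.cong) auto
  then show ?thesis
    by (simp add: series_scale_def)
qed

lemma series_pcomp_nth:
  "fps_nth (series_pcomp m n i F G) k = (\<Sum>j\<le>k. pcomp m n i (fps_nth F j) (fps_nth G (k - j)))"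
  by (simp add: series_pcomp_def)

text \<open>The signs are constants of \<open>K[[t]]\<close>, so scaling by them acts
  coefficientwise, and the sum over the insertion position \<open>i\<close> can be exchanged with
  the Cauchy sum.\<close>

lemma series_circle_nth:
  "fps_nth (series_circle m n F G) k = (\<Sum>j\<le>k. circle m n (fps_nth F j) (fps_nth G (k - j)))"
proof -
  have const: "(- 1 :: 'k fps) ^ l = fps_const ((- 1) ^ l)" for l
    by (metis fps_const_1_eq_1 fps_const_neg fps_const_power)
  show ?thesis
    unfolding series_circle_def circle_def const fps_sum_nth series_scale_const_nth
      series_pcomp_nth scale_sum_right
    by (rule sum.swap)
qed

lemma series_pcomp_closed:
  assumes "1 \<le> i" "i \<le> m" "1 \<le> n" "F \<in> Op_series m" "G \<in> Op_series n"
  shows "series_pcomp m n i F G \<in> Op_series (m + n - 1)"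
  using assms by (auto simp: Op_series_def series_pcomp_nth simp del: One_nat_def
      intro!: Op_sum pcomp_closed)

lemma series_circle_closed:
  assumes "1 \<le> m" "1 \<le> n" "F \<in> Op_series m" "G \<in> Op_series n"
  shows "series_circle m n F G \<in> Op_series (m + n - 1)"
  using assms by (auto simp: Op_series_def series_circle_nth simp del: One_nat_def
      intro!: Op_sum circle_closed)

lemma series_gamma_closed:
  assumes "F \<in> Op_series 2" "G \<in> Op_series 1" "H \<in> Op_series 1"
  shows "series_gamma F G H \<in> Op_series 2"
  using assms series_pcomp_closed[of 2 2 1 F H] series_pcomp_closed[of 1 2 1 _ G]
  by (simp add: series_gamma_def)

text \<open>Conversely to reading off coefficients, a difference whose first \<open>N\<close>
  coefficients vanish can be divided by \<open>t^N\<close>: the quotient is its shift, whose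
  coefficients stay in the subspace \<open>Op n\<close>.\<close>

lemma cong_mod_t_iff:
  assumes "n \<ge> 1" "F \<in> Op_series n" "G \<in> Op_series n"
  shows "cong_mod_t n N F G \<longleftrightarrow> (\<forall>k<N. fps_nth F k = fps_nth G k)"
proof
  assume "cong_mod_t n N F G"
  then obtain H where "F - G = series_scale (fps_X ^ N) H"
    by (auto simp: cong_mod_t_def)
  then have "fps_nth F k - fps_nth G k = (if k < N then 0 else fps_nth H (k - N))" for k
    by (metis fps_sub_nth series_scale_X_power_nth)
  then show "\<forall>k<N. fps_nth F k = fps_nth G k"
    by (metis eq_iff_diff_eq_0)
next
  assume eq: "\<forall>k<N. fps_nth F k = fps_nth G k"
  define H where "H = Abs_fps (\<lambda>k. fps_nth (F - G) (k + N))"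
  have "H \<in> Op_series n"
    using assms by (auto simp: H_def Op_series_def)
  moreover have "F - G = series_scale (fps_X ^ N) H"
    by (rule fps_ext) (simp add: series_scale_X_power_nth H_def eq)
  ultimately show "cong_mod_t n N F G"
    by (auto simp: cong_mod_t_def)
qed

lemma linear_series_nth:
  "fps_nth (linear_series x y) k = (if k = 0 then x else if k = 1 then y else 0)"
  using series_scale_X_power_nth[of 1 "fps_const y" k] by (auto simp: linear_series_def)

lemma linear_series_closed:
  "\<lbrakk>n \<ge> 1; x \<in> Op n; y \<in> Op n\<rbrakk> \<Longrightarrow> linear_series x y \<in> Op_series n"
  by (simp add: Op_series_def linear_series_nth)

lemma linear_series_eq_iff: "linear_series x y = linear_series x y' \<longleftrightarrow> y = y'"
  by (metis linear_series_nth zero_neq_one)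

lemma atMost_1_nat: "{..1::nat} = {0, 1}"
  by auto

lemma less_two_iff: "(\<forall>k<2. P k) \<longleftrightarrow> P 0 \<and> P (1::nat)"
  by (auto simp: less_2_cases_iff)

section \<open>Deformations, their equivalence, and the resulting classes\<close>

lemma inf_deformations_eq_image:
  assumes "multiplication \<pi>"
  shows "inf_deformations \<pi> = linear_series \<pi> ` cocycles \<pi> 2"
proof -
  have \<pi>: "\<pi> \<in> Op 2" "circle 2 2 \<pi> \<pi> = 0"
    using assms by (auto simp: multiplication_def)
  have "cong_mod_t 3 2 (series_circle 2 2 (linear_series \<pi> x) (linear_series \<pi> x)) 0 \<longleftrightarrow>
      differential \<pi> 2 x = 0" if "x \<in> Op 2" for x
  proof -
    have "series_circle 2 2 (linear_series \<pi> x) (linear_series \<pi> x) \<in> Op_series 3"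
      using series_circle_closed[of 2 2] linear_series_closed[of 2 \<pi> x] \<pi> that by simp
    moreover have "0 \<in> Op_series 3"
      by (simp add: Op_series_def)
    \<comment> \<open>Only the coefficients at 0 and 1 count. The first is the circle product of
      \<open>\<pi>\<close> with itself, hence 0; the second is
      \<open>differential \<pi> 2 x\<close>, whose sign \<open>- (- 1) ^ (2 - 1)\<close> is a
      plus.\<close>
    ultimately show ?thesis
      by (simp add: cong_mod_t_iff less_two_iff series_circle_nth linear_series_nth \<pi>
          differential_def)
  qed
  then show ?thesis
    by (auto simp: inf_deformations_def cocycles_def)
qed

text \<open>Products of two first-order terms start at \<open>t^2\<close>, and in all other terms
  the unit axioms remove \<open>ident\<close>. What remains at \<open>t\<close> is linear in
  \<open>x\<close>, \<open>y\<close> and \<open>\<phi>1\<close>.\<close>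

lemma gauge_equation_iff:
  assumes \<pi>: "\<pi> \<in> Op 2" and x: "x \<in> Op 2" and y: "y \<in> Op 2" and \<phi>: "\<phi>1 \<in> Op 1"
  defines "\<phi> \<equiv> linear_series ident \<phi>1"
  shows "cong_mod_t 2 2 (series_circle 1 2 \<phi> (linear_series \<pi> y))
      (series_gamma (linear_series \<pi> x) \<phi> \<phi>) \<longleftrightarrow> y - x = differential \<pi> 1 \<phi>1"
proof -
  have mem: "\<phi> \<in> Op_series 1" "linear_series \<pi> x \<in> Op_series 2" "linear_series \<pi> y \<in> Op_series 2"
    using assms ident_mem by (simp_all add: linear_series_closed)
  have "series_circle 1 2 \<phi> (linear_series \<pi> y) \<in> Op_series 2"
    using series_circle_closed[of 1 2] mem by (simp del: One_nat_def)
  moreover have "series_gamma (linear_series \<pi> x) \<phi> \<phi> \<in> Op_series 2"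
    using series_gamma_closed mem by simp
  ultimately have "cong_mod_t 2 2 (series_circle 1 2 \<phi> (linear_series \<pi> y))
      (series_gamma (linear_series \<pi> x) \<phi> \<phi>) \<longleftrightarrow>
      (\<forall>k<2. fps_nth (series_circle 1 2 \<phi> (linear_series \<pi> y)) k =
        fps_nth (series_gamma (linear_series \<pi> x) \<phi> \<phi>) k)"
    by (intro cong_mod_t_iff) simp_all
  moreover have "fps_nth (series_circle 1 2 \<phi> (linear_series \<pi> y)) 0 = \<pi>"
    using \<pi> by (simp add: series_circle_nth circle_1_left \<phi>_def linear_series_nth
        pcomp_ident_left del: One_nat_def)
  moreover have "fps_nth (series_circle 1 2 \<phi> (linear_series \<pi> y)) 1 = y + circle 1 2 \<phi>1 \<pi>"
    using y by (simp add: series_circle_nth circle_1_left \<phi>_def linear_series_nth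
        atMost_1_nat pcomp_ident_left del: One_nat_def)
  moreover have "fps_nth (series_gamma (linear_series \<pi> x) \<phi> \<phi>) 0 = \<pi>"
    using \<pi> by (simp add: series_gamma_def series_pcomp_nth \<phi>_def linear_series_nth
        pcomp_ident_right del: One_nat_def)
  moreover have "fps_nth (series_gamma (linear_series \<pi> x) \<phi> \<phi>) 1 = x + circle 2 1 \<pi> \<phi>1"
  proof -
    \<comment> \<open>The inner composition has \<open>t\<close>-coefficient
      \<open>pcomp 2 1 2 \<pi> \<phi>1 + x\<close>; it must lie in \<open>Op 2\<close> before the
      right unit axiom can absorb the outer \<open>ident\<close>.\<close>
    have "pcomp 2 1 2 \<pi> \<phi>1 \<in> Op 2"
      using pcomp_closed[of 2 2 1 \<pi> \<phi>1] \<pi> \<phi> by simp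
    then show ?thesis
      using \<pi> x by (simp add: series_gamma_def series_pcomp_nth \<phi>_def linear_series_nth
          circle_2_left atMost_1_nat pcomp_ident_right Op_add ac_simps del: One_nat_def)
  qed
  \<comment> \<open>In arity 1 the sign in \<open>differential\<close> is \<open>(- 1) ^ 0\<close>,
    so the differential of \<open>\<phi>1\<close> is
    \<open>circle 2 1 \<pi> \<phi>1 - circle 1 2 \<phi>1 \<pi>\<close>.\<close>
  ultimately show ?thesis
    by (auto simp: less_two_iff differential_def algebra_simps simp del: One_nat_def)
qed

lemma inf_deformation_equiv_eq_image:
  assumes "multiplication \<pi>"
  shows "inf_deformation_equiv \<pi> =
    map_prod (linear_series \<pi>) (linear_series \<pi>) ` cohomologous \<pi> 2"
proof -
  have \<pi>: "\<pi> \<in> Op 2"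
    using assms by (simp add: multiplication_def)
  have "(linear_series \<pi> x, linear_series \<pi> y) \<in> inf_deformation_equiv \<pi> \<longleftrightarrow>
      (x, y) \<in> cohomologous \<pi> 2" if "x \<in> cocycles \<pi> 2" "y \<in> cocycles \<pi> 2" for x y
  proof -
    have mem: "x \<in> Op 2" "y \<in> Op 2"
      using that by (auto simp: cocycles_def)
    have "(linear_series \<pi> x, linear_series \<pi> y) \<in> inf_deformation_equiv \<pi> \<longleftrightarrow>
        (\<exists>\<phi>1\<in>Op 1. y - x = differential \<pi> 1 \<phi>1)"
      using that mem \<pi>
      by (simp add: inf_deformation_equiv_def inf_deformations_eq_image[OF assms] Let_def
          gauge_equation_iff del: One_nat_def)
    \<comment> \<open>The gauge equation yields the difference \<open>y - x\<close>, opposite to the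
      order in \<open>cohomologous\<close>; the pair is therefore swapped first and restored by
      symmetry.\<close>
    also have "\<dots> \<longleftrightarrow> (y, x) \<in> cohomologous \<pi> 2"
      using that by (auto simp: cohomologous_def coboundaries_def)
    also have "\<dots> \<longleftrightarrow> (x, y) \<in> cohomologous \<pi> 2"
      using equiv_cohomologous[OF \<pi>, of 2] by (auto simp: equiv_def dest: symD)
    finally show ?thesis .
  qed
  \<comment> \<open>Each relation is confined to cocycles or their images, so agreement on pairs of
    cocycles gives equality of the sets.\<close>
  moreover have "inf_deformation_equiv \<pi> \<subseteq>
      linear_series \<pi> ` cocycles \<pi> 2 \<times> linear_series \<pi> ` cocycles \<pi> 2"
    by (auto simp: inf_deformation_equiv_def inf_deformations_eq_image[OF assms])
  moreover have "cohomologous \<pi> 2 \<subseteq> cocycles \<pi> 2 \<times> cocycles \<pi> 2"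
    by (auto simp: cohomologous_def)
  ultimately show ?thesis
    by (fastforce simp: map_prod_def)
qed

text \<open>The last clause prescribes the value of \<open>\<Phi>\<close> on every class, so the
  bijection is the one induced by \<open>\<pi> + x t \<mapsto> x\<close> and not a mere comparison
  of cardinalities.\<close>

lemma inf_deformation_classes_bij_cohomology:
  assumes "multiplication \<pi>"
  defines "R \<equiv> inf_deformation_equiv \<pi>"
  shows "equiv (inf_deformations \<pi>) R"
    and "\<exists>\<Phi>. bij_betw \<Phi> (inf_deformations \<pi> // R) (cohomology \<pi> 2) \<and>
      (\<forall>x. linear_series \<pi> x \<in> inf_deformations \<pi> \<longrightarrow>
        \<Phi> (R `` {linear_series \<pi> x}) = cohomologous \<pi> 2 `` {x})"
proof -
  let ?L = "linear_series \<pi>"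
  let ?Z = "cocycles \<pi> 2" and ?C = "cohomologous \<pi> 2"
  have eqv: "equiv ?Z ?C"
    using assms equiv_cohomologous by (simp add: multiplication_def)
  then have sub: "?C \<subseteq> ?Z \<times> ?Z"
    by (simp add: equiv_def)
  have inj: "inj ?L"
    by (simp add: inj_def linear_series_eq_iff)
  then have inj_Z: "inj_on ?L ?Z"
    by (rule inj_on_subset) simp
  note Def_eq = inf_deformations_eq_image[OF assms(1)]
  have R_eq: "R = map_prod ?L ?L ` ?C"
    unfolding R_def by (rule inf_deformation_equiv_eq_image[OF assms(1)])
  show "equiv (inf_deformations \<pi>) R"
    unfolding Def_eq R_eq by (rule equiv_map_prod_image[OF eqv inj_Z])
  have vimage: "?L -` (?L ` S) = S" for S
    by (rule inj_vimage_image_eq[OF inj])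
  \<comment> \<open>Classes are sets, so taking preimages under \<open>?L\<close> serves as the map
    of quotients. Deformation classes are exactly the images of cohomology classes, and
    \<open>?L\<close> is injective, so taking images is the inverse.\<close>
  have "bij_betw ((-`) ?L) (inf_deformations \<pi> // R) (cohomology \<pi> 2)"
    unfolding Def_eq R_eq quotient_map_prod_image[OF sub inj_Z] cohomology_def
    by (rule bij_betwI[where g = "(`) ?L"]) (auto simp: vimage)
  moreover have "?L -` (R `` {?L x}) = ?C `` {x}" if "?L x \<in> inf_deformations \<pi>" for x
  proof -
    have "x \<in> ?Z"
      using that by (auto simp: Def_eq linear_series_eq_iff)
    show ?thesis
      unfolding R_eq map_prod_image_Image[OF sub inj_Z \<open>x \<in> ?Z\<close>] vimage ..
  qed
  ultimately show "\<exists>\<Phi>. bij_betw \<Phi> (inf_deformations \<pi> // R) (cohomology \<pi> 2) \<and>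
      (\<forall>x. ?L x \<in> inf_deformations \<pi> \<longrightarrow> \<Phi> (R `` {?L x}) = ?C `` {x})"
    by blast
qed

end

theorem proposition3p3:
  fixes scale :: "'k::field_char_0 \<Rightarrow> 'v::ab_group_add \<Rightarrow> 'v"
    and Op :: "nat \<Rightarrow> 'v set"
    and pcomp :: "nat \<Rightarrow> nat \<Rightarrow> nat \<Rightarrow> 'v \<Rightarrow> 'v \<Rightarrow> 'v"
    and ident :: 'v
    and \<pi> :: 'v
  assumes "ns_operad scale Op pcomp ident"
    and "ns_operad.multiplication scale Op pcomp \<pi>"
  defines "Def \<equiv> ns_operad.inf_deformations scale Op pcomp \<pi>"
    and "R \<equiv> ns_operad.inf_deformation_equiv scale Op pcomp ident \<pi>"
  shows "equiv Def R \<and>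
    (\<exists>\<Phi>. bij_betw \<Phi> (Def // R) (ns_operad.cohomology scale Op pcomp \<pi> 2) \<and>
      (\<forall>\<pi>1. ns_operad.linear_series scale \<pi> \<pi>1 \<in> Def \<longrightarrow>
        \<Phi> (R `` {ns_operad.linear_series scale \<pi> \<pi>1}) =
          ns_operad.cohomologous scale Op pcomp \<pi> 2 `` {\<pi>1}))"
proof -
  interpret ns_operad scale Op pcomp ident
    by fact
  show ?thesis
    using inf_deformation_classes_bij_cohomology[OF assms(2)] unfolding Def_def R_def by blast
qed

end
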